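(* Let $p$ be a prime, let $e\geq 1$ be an integer, and let $q=p^{e}$. Let $A\subseteq\mathrm{Aff}(\mathbb{F}_{q})$ with $A=A^{-1}$ and $|A^{3}|=C|A|$ for a real number $C$. Then either (a) $A\subseteq\mathrm{Stab}(x)$ for some $x\in\mathbb{F}_{q}$, or the following statements (b) and (c), according to the size of $A$, hold: (b) if $1<|A|\leq q$, then $|\pi(A)|<(p^{\lfloor e/2\rfloor}+2)C^{4}$; and if $q<|A|<(3+2\sqrt{2})q$, then $|\pi(A)|<(4+2\sqrt{2})C^{4}$; (c) if $|A|\geq(3+2\sqrt{2})q$, then $|\pi(A)|<\frac{2}{q}C^{3}|A|$ and $A^{8}\supseteq U$.
   Context: For a finite field $\mathbb{F}$, the affine group is $$\mathrm{Aff}(\mathbb{F})=\left\{\begin{pmatrix}a&b\\0&1\end{pmatrix}\ :\ a\in\mathbb{F}^{*},\ b\in\mathbb{F}\right\}$$ under matrix multiplication; it is identified with $\mathbb{F}^{*}\times\mathbb{F}$ by letting the matrix $\begin{pmatrix}a&b\\0&1\end{pmatrix}$ correspond to $(a,b)$. The map $\pi:\mathrm{Aff}(\mathbb{F})\to\mathbb{F}^{*}$ is the projection $(a,b)\mapsto a$. The group $\mathrm{Aff}(\mathbb{F})$ acts on $\mathbb{F}$ by $(a,b)\cdot x=ax+b$, and $\mathrm{Stab}(x)$ is the stabilizer of $x\in\mathbb{F}$ under this action. $U$ is the unipotent subgroup corresponding to $\{1\}\times\mathbb{F}$. For a subset $A$ of a group, $A^{-1}=\{g^{-1}:g\in A\}$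 and $A^{k}=\{g_1g_2\cdots g_k: g_1,\dots,g_k\in A\}$. *)

theory Defs
  imports
    "HOL-Computational_Algebra.Primes"
    "HOL-Analysis.Cartesian_Space"
    "HOL-Algebra.Group_Action"
begin

text \<open>
  The group \<open>Aff(F)\<close> in the coordinates \<open>F\<^sup>* \<times> F\<close>. The pair \<open>(a, b)\<close> stands for the matrix
  \<open>aff_matrix (a, b)\<close> below; the lemmas \<open>bij_betw_aff_matrix\<close>, \<open>aff_matrix_mult\<close> and
  \<open>aff_matrix_one\<close> justify this identification.
\<close>

definition aff_group :: "('a::field \<times> 'a) monoid" where
  "aff_group =
     \<lparr>carrier = {(a, b). a \<noteq> 0},
      mult = (\<lambda>(a, b) (c, d). (a * c, a * d + b)),
      one = (1, 0)\<rparr>"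

definition aff_matrix :: "'a::field \<times> 'a \<Rightarrow> 'a^2^2" where
  "aff_matrix = (\<lambda>(a, b). vector [vector [a, b], vector [0, 1]])"

definition aff_proj :: "'a::field \<times> 'a \<Rightarrow> 'a" where
  "aff_proj = (\<lambda>(a, b). a)"

definition aff_act :: "'a::field \<times> 'a \<Rightarrow> 'a \<Rightarrow> 'a" where
  "aff_act = (\<lambda>(a, b) x. a * x + b)"

definition aff_unipotent :: "('a::field \<times> 'a) set" where
  "aff_unipotent = {1} \<times> UNIV"

primrec set_pow :: "('g, 'm) monoid_scheme \<Rightarrow> 'g set \<Rightarrow> nat \<Rightarrow> 'g set" where
  "set_pow G A 0 = {\<one>\<^bsub>G\<^esub>}"
| "set_pow G A (Suc k) = set_pow G A k <#>\<^bsub>G\<^esub> A"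

lemma carrier_aff_group: "(a, b) \<in> carrier aff_group \<longleftrightarrow> a \<noteq> 0"
  by (simp add: aff_group_def)

lemma mult_aff_group: "(a, b) \<otimes>\<^bsub>aff_group\<^esub> (c, d) = (a * c, a * d + b)"
  by (simp add: aff_group_def)

lemma one_aff_group: "\<one>\<^bsub>aff_group\<^esub> = (1, 0)"
  by (simp add: aff_group_def)

lemma group_aff_group: "group (aff_group :: ('a::field \<times> 'a) monoid)"
proof (rule groupI)
  fix x :: "'a \<times> 'a"
  assume "x \<in> carrier aff_group"
  then obtain a b where x: "x = (a, b)" "a \<noteq> 0"
    by (cases x) (simp add: carrier_aff_group)
  show "\<exists>y\<in>carrier aff_group. y \<otimes>\<^bsub>aff_group\<^esub> x = \<one>\<^bsub>aff_group\<^esub>"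
    by (rule bexI[of _ "(inverse a, - inverse a * b)"])
      (simp_all add: x carrier_aff_group mult_aff_group one_aff_group)
qed (auto simp: aff_group_def algebra_simps)

lemma bij_betw_aff_matrix:
  "bij_betw aff_matrix (carrier aff_group)
     {M :: 'a::field^2^2. M $ 1 $ 1 \<noteq> 0 \<and> M $ 2 $ 1 = 0 \<and> M $ 2 $ 2 = 1}"
  by (rule bij_betw_byWitness[where f' = "\<lambda>M. (M $ 1 $ 1, M $ 1 $ 2)"])
    (auto simp: aff_group_def aff_matrix_def vec_eq_iff forall_2)

lemma aff_matrix_mult: "aff_matrix (g \<otimes>\<^bsub>aff_group\<^esub> h) = aff_matrix g ** aff_matrix h"
  by (cases g, cases h)
    (simp add: mult_aff_group aff_matrix_def vec_eq_iff forall_2 matrix_matrix_mult_def sum_2)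

lemma aff_matrix_one: "aff_matrix \<one>\<^bsub>aff_group\<^esub> = mat 1"
  by (simp add: one_aff_group aff_matrix_def vec_eq_iff forall_2 mat_def)

lemma group_action_aff_act: "group_action aff_group (UNIV :: 'a::field set) aff_act"
proof -
  have bij: "bij (aff_act g)" if g: "g \<in> carrier aff_group" for g :: "'a \<times> 'a"
  proof -
    obtain a b where ab: "g = (a, b)" "a \<noteq> 0"
      using g by (cases g) (simp add: carrier_aff_group)
    show ?thesis
      by (rule o_bij[where g = "\<lambda>y. (y - b) / a"]) (auto simp: ab aff_act_def fun_eq_iff)
  qed
  have Bij: "aff_act g \<in> Bij UNIV" if "g \<in> carrier aff_group" for g :: "'a \<times> 'a"
    using bij[OF that] by (simp add: Bij_def extensional_def)
  have "aff_act \<in> hom aff_group (BijGroup (UNIV :: 'a set))"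
    by (rule homI)
      (use Bij in \<open>auto simp: BijGroup_def compose_def fun_eq_iff mult_aff_group aff_act_def algebra_simps\<close>)
  then show ?thesis
    by (simp add: group_action_def group_hom_def group_hom_axioms_def group_aff_group group_BijGroup)
qed

end

theory Submission
  imports
    Defs
    "HOL-Computational_Algebra.Polynomial"
    "HOL-Analysis.Convex"
begin

text \<open>
  If \<open>g \<in> A\<^sup>2\<close> is a nontrivial element fixing \<open>x\<close>, then the conjugates \<open>a g a\<^bsup>-1\<^esup>\<close> with \<open>a \<in> A\<close> lie in one
  fibre of \<open>\<pi>\<close> inside \<open>A\<^sup>4\<close> and correspond to the points of \<open>A \<cdot> x\<close>. Translating this fibre by
  representatives of \<open>\<pi>(A)\<close> gives \<open>|\<pi>(A)| |A \<cdot> x| \<le> |A\<^sup>5| \<le> C\<^sup>3 |A|\<close> by Ruzsa's triangle inequality,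
  and so, by pigeonhole, \<open>|\<pi>(A)| \<le> C\<^sup>3 |A\<^sup>2 \<inter> Stab(x)|\<close>. The sets \<open>A\<^sup>2 \<inter> Stab(x) - {1}\<close> are disjoint,
  hence \<open>|\<pi>(A)|\<close> is bounded in terms of \<open>|A|\<close> over the number of such \<open>x\<close>, which are the
  non-vertical directions determined by \<open>A\<close> as a subset of the plane. More than \<open>q\<close> points
  determine all directions; for at most \<open>q\<close> points the number of directions is bounded below by
  the lacunary polynomial method of Redei and Szonyi. For \<open>|A| > q\<close> some orbit \<open>A \<cdot> x\<close> has more than
  \<open>q / 2\<close> elements, which gives the sharper bound on \<open>|\<pi>(A)|\<close>, and the quotients of the
  corresponding conjugates fill \<open>U\<close>.
\<close>

section \<open>Lacunary polynomials over finite fields\<close>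

lemma power_card_eq_same:
  fixes x :: "'a :: {field, finite}"
  shows "x ^ CARD('a) = x"
proof (cases "x = 0")
  case False
  have "(\<Prod>y\<in>UNIV - {0::'a}. y) = (\<Prod>y\<in>UNIV - {0}. x * y)"
    by (rule prod.reindex_bij_witness[of _ "\<lambda>y. x * y" "\<lambda>y. y / x"]) (use False in auto)
  also have "\<dots> = x ^ (CARD('a) - 1) * (\<Prod>y\<in>UNIV - {0}. y)"
    by (simp add: prod.distrib card_Diff_singleton)
  finally have "x ^ (CARD('a) - 1) = 1"
    by simp
  moreover have "Suc (CARD('a) - 1) = CARD('a)"
    by (simp add: card_gt_0_iff)
  ultimately show ?thesis
    by (metis mult.right_neutral power_Suc)
qed (simp add: card_gt_0_iff)

lemma CHAR_eq_prime:
  fixes p e :: nat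
  assumes "prime p" "CARD('a :: {field, finite}) = p ^ e"
  shows "CHAR('a) = p"
proof -
  have "of_nat (CARD('a)) = (0 :: 'a)"
  proof -
    have "(\<Sum>x\<in>UNIV. x) = (\<Sum>x\<in>UNIV. x + 1 :: 'a)"
      by (rule sum.reindex_bij_witness[of _ "\<lambda>x. x + 1" "\<lambda>x. x - 1"]) auto
    also have "\<dots> = (\<Sum>x\<in>UNIV. x) + of_nat (CARD('a))"
      by (simp add: sum.distrib)
    finally show ?thesis by simp
  qed
  then have *: "CHAR('a) dvd p ^ e"
    by (metis of_nat_eq_0_iff_char_dvd assms(2))
  have "prime CHAR('a)"
    by (simp add: prime_CHAR_semidom finite_imp_CHAR_pos)
  then show ?thesis
    using * assms(1) prime_dvd_power primes_dvd_imp_eq by blast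
qed

text \<open>A zero derivative leaves only exponents divisible by \<open>p\<close>. Since
  \<open>x ^ (p ^ e) = x\<close>, the map \<open>s\<close> takes \<open>p\<close>-th roots of the
  coefficients, and additivity of Frobenius assembles the root.\<close>

lemma pderiv_eq_0_imp_power:
  fixes G :: "'a :: {field, finite} poly"
  assumes "prime p" "CARD('a) = p ^ e" "e \<ge> 1" "pderiv G = 0"
  obtains H where "G = H ^ p"
proof
  have ch: "CHAR('a) = p"
    using CHAR_eq_prime assms by blast
  define s where "s = (\<lambda>x :: 'a. x ^ (p ^ (e - 1)))"
  have s: "s x ^ p = x" for x
  proof -
    have "s x ^ p = x ^ (p ^ Suc (e - 1))"
      by (simp add: s_def flip: power_mult) (simp add: mult.commute)
    then show ?thesis
      using power_card_eq_same[of x] assms by simp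
  qed
  have p0: "p > 0"
    using assms(1) prime_gt_0_nat by blast
  show "G = (\<Sum>i\<le>degree G. monom (s (coeff G (p * i))) i) ^ p"
  proof (rule poly_eqI)
    fix m
    have "(\<Sum>i\<le>degree G. monom (s (coeff G (p * i))) i) ^ p =
      (\<Sum>i\<le>degree G. monom (s (coeff G (p * i))) i ^ p)"
      by (subst freshmans_dream_sum) (use assms ch in auto)
    also have "\<dots> = (\<Sum>i\<le>degree G. monom (coeff G (p * i)) (p * i))"
      by (simp add: monom_power s mult.commute)
    finally have "coeff ((\<Sum>i\<le>degree G. monom (s (coeff G (p * i))) i) ^ p) m =
      (\<Sum>i\<le>degree G. if p * i = m then coeff G m else 0)"
      by (auto simp: coeff_sum intro!: sum.cong)
    also have "\<dots> = coeff G m"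
    proof (cases "p dvd m")
      case True
      then obtain i where i: "m = p * i" by blast
      have "(\<Sum>i\<le>degree G. if p * i = m then coeff G m else 0) =
        (\<Sum>j\<le>degree G. if j = i then coeff G m else 0)"
        using i p0 by (auto intro!: sum.cong)
      also have "\<dots> = coeff G m"
        using i p0 coeff_eq_0[of G m]
        by (auto simp: sum.delta) (metis le_add1 le_trans linorder_not_less mult.commute mult_le_mono2 mult_1_right Suc_leI One_nat_def)
      finally show ?thesis .
    next
      case False
      then have "m > 0" by (cases m) auto
      have "coeff (pderiv G) (m - 1) = 0"
        using assms by simp
      then have "of_nat m * coeff G m = 0"
        using \<open>m > 0\<close> by (simp add: coeff_pderiv)
      moreover have "of_nat m \<noteq> (0 :: 'a)"
        using False by (simp add: of_nat_eq_0_iff_char_dvd ch)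
      moreover have "p * i \<noteq> m" for i
        using False by auto
      ultimately show ?thesis
        by simp
    qed
    finally show "coeff G m = coeff ((\<Sum>i\<le>degree G. monom (s (coeff G (p * i))) i) ^ p) m" ..
  qed
qed

text \<open>Splitting off a \<open>p\<close>-th power divides the degree by \<open>p\<close>, so
  this stops at a polynomial with nonzero derivative; \<open>k = 0\<close> is allowed.\<close>

lemma power_of_separable:
  fixes G :: "'a :: {field, finite} poly"
  assumes "prime p" "CARD('a) = p ^ e" "e \<ge> 1" "degree G > 0"
  shows "\<exists>k h. G = h ^ (p ^ k) \<and> pderiv h \<noteq> 0"
  using assms(4)
proof (induction "degree G" arbitrary: G rule: less_induct)
  case less
  show ?case
  proof (cases "pderiv G = 0")
    case True
    then obtain H where H: "G = H ^ p"
      using pderiv_eq_0_imp_power assms by blast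
    have "degree G = p * degree H"
      unfolding H by (cases "H = 0") (use assms prime_gt_0_nat[of p] in \<open>auto simp: degree_power_eq power_0_left\<close>)
    moreover have "p > 1"
      using assms prime_gt_1_nat by blast
    ultimately have "degree H < degree G" "degree H > 0"
      using less.prems by auto
    then obtain k h where "H = h ^ (p ^ k)" "pderiv h \<noteq> 0"
      using less.hyps by blast
    then have "G = h ^ (p ^ Suc k)"
      by (simp add: H mult.commute flip: power_mult)
    then show ?thesis
      using \<open>pderiv h \<noteq> 0\<close> by blast
  next
    case False
    then show ?thesis
      by (intro exI[of _ 0] exI[of _ G]) simp
  qed
qed

lemma linear_power_dvd_pderiv:
  assumes "[:- a, 1:] ^ Suc m dvd (u :: 'a :: idom poly)"
  shows "[:- a, 1:] ^ m dvd pderiv u"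
proof -
  obtain v where "u = [:- a, 1:] ^ Suc m * v"
    using assms by blast
  then show ?thesis
    using le_imp_power_dvd[of m "Suc m" "[:- a, 1:]"]
    by (auto simp only: lemma_order_pderiv1 intro!: dvd_add dvd_smult dvd_mult2 dvd_triv_right)
qed

lemma order_power:
  "u \<noteq> 0 \<Longrightarrow> order a (u ^ k :: 'a :: idom poly) = k * order a u"
  by (induction k) (simp_all add: order_mult)

text \<open>The Redei-Szonyi argument; the \<open>c i\<close> may repeat. Writing
  \<open>G = h ^ t\<close> with \<open>t = p ^ k\<close> makes \<open>X^q + G\<close> the
  \<open>t\<close>-th power of \<open>V = X^(q/t) + h\<close>, and \<open>V' = h'\<close> limits the
  multiplicities of its roots.\<close>

lemma lacunary_degree_bound:
  fixes G :: "'a :: {field, finite} poly"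
  assumes p: "prime p" "CARD('a) = p ^ e" "e \<ge> 1"
    and "finite I" "(\<Prod>i\<in>I. [:- c i, 1:]) dvd monom 1 CARD('a) + G"
    and G: "monom 1 1 + G \<noteq> 0" "degree G > 0" "degree G < CARD('a)"
  obtains k where "p ^ k \<le> degree G" "card I + p ^ k \<le> (p ^ k + 1) * degree G"
proof -
  obtain k h where h: "G = h ^ (p ^ k)" "pderiv h \<noteq> 0"
    using power_of_separable p G by blast
  have ch: "CHAR('a) = p"
    using CHAR_eq_prime p by blast
  define t where "t = p ^ k"
  have p1: "p > 1"
    using p prime_gt_1_nat by blast
  have t: "t > 0"
    using p1 by (simp add: t_def)
  have "h \<noteq> 0" using h by auto
  have deg: "degree G = t * degree h"
    using \<open>h \<noteq> 0\<close> by (simp add: h degree_power_eq t_def)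
  have "degree h > 0"
    using G deg by (cases "degree h") auto
  then have "t \<le> degree G"
    using deg by simp
  \<comment> \<open>Strictness leaves a factor \<open>p\<close> in \<open>q / t\<close>, so the
    leading power of \<open>V\<close> has derivative 0.\<close>
  then have "p ^ k < p ^ e"
    using G p by (simp add: t_def)
  then have ke: "k < e"
    using p1 power_less_imp_less_exp by blast
  define V where "V = monom 1 (p ^ (e - k)) + h"
  have q: "p ^ (e - k) * t = CARD('a)"
    using ke by (simp add: t_def p flip: power_add)
  have V_t: "V ^ t = monom 1 CARD('a) + G"
    unfolding V_def t_def
    by (subst freshmans_dream') (use ch p q in \<open>auto simp: monom_power h t_def\<close>)
  have "p ^ (e - k) * t > degree h * t"
    using deg G q by (simp add: mult.commute)
  then have "degree h < p ^ (e - k)"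
    by simp
  then have "coeff V (p ^ (e - k)) = 1"
    by (simp add: V_def coeff_eq_0)
  then have "V \<noteq> 0" by auto
  have "of_nat (p ^ (e - k)) = (0 :: 'a)"
    using ke ch by (subst of_nat_eq_0_iff_char_dvd) simp
  then have pderiv_V: "pderiv V = pderiv h"
    by (simp add: V_def pderiv_add pderiv_monom)
  \<comment> \<open>A root of multiplicity \<open>m\<close> of \<open>V\<close> is a root of multiplicity at least \<open>m - 1\<close> of \<open>h'\<close>, and
    a root of \<open>X + G\<close> as it lies in the field; so the product divides \<open>W\<close>.\<close>
  define W where "W = (monom 1 1 + G) ^ t * pderiv h ^ t"
  have "W \<noteq> 0"
    using G h by (simp add: W_def)
  define r where "r = (\<Prod>i\<in>I. [:- c i, 1:])"
  have "r \<noteq> 0"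
    using \<open>finite I\<close> by (simp add: r_def)
  have "order \<alpha> r \<le> order \<alpha> W" for \<alpha>
  proof (cases "order \<alpha> r = 0")
    case False
    have "order \<alpha> r \<le> order \<alpha> (V ^ t)"
      using assms(5) \<open>V \<noteq> 0\<close>
      by (intro dvd_imp_order_le power_not_zero) (simp_all add: r_def V_t)
    also have "\<dots> = t * order \<alpha> V"
      by (simp add: order_power \<open>V \<noteq> 0\<close>)
    finally have le: "order \<alpha> r \<le> t * order \<alpha> V" .
    then have "order \<alpha> V \<noteq> 0"
      using False by (metis le_zero_eq mult_0_right)
    then obtain m where m: "order \<alpha> V = Suc m"
      by (cases "order \<alpha> V") auto
    have "[:- \<alpha>, 1:] ^ m dvd pderiv V"
      using order_1[of \<alpha> V] by (intro linear_power_dvd_pderiv) (simp only: m)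
    then have "m \<le> order \<alpha> (pderiv h)"
      using h by (simp add: pderiv_V order_divides)
    moreover have "order \<alpha> (monom 1 1 + G) \<ge> 1"
    proof -
      have "poly V \<alpha> = 0"
        using m order_root by force
      then have "poly (V ^ t) \<alpha> = 0"
        using t by simp
      then have "poly (monom 1 1 + G) \<alpha> = 0"
        using V_t power_card_eq_same[of \<alpha>] by (simp add: poly_monom)
      then show ?thesis
        using G order_root[of "monom 1 1 + G" \<alpha>] by simp
    qed
    ultimately have "t * Suc m \<le> order \<alpha> W"
    proof -
      assume a: "m \<le> order \<alpha> (pderiv h)" "1 \<le> order \<alpha> (monom 1 1 + G)"
      have "order \<alpha> W = t * (order \<alpha> (monom 1 1 + G) + order \<alpha> (pderiv h))"
        using G h \<open>W \<noteq> 0\<close> by (simp add: W_def order_mult order_power distrib_left)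
      then show ?thesis
        using a by (simp del: mult_Suc_right)
    qed
    then show ?thesis
      using le m by simp
  qed simp
  then have "proots r \<subseteq># proots W"
    using \<open>r \<noteq> 0\<close> \<open>W \<noteq> 0\<close> by (simp add: subseteq_mset_def)
  then have "size (proots r) \<le> degree W"
    using size_mset_mono size_proots_le order_trans by blast
  moreover have "proots r = (\<Sum>i\<in>I. {#c i#})"
    unfolding r_def using \<open>finite I\<close> by (subst proots_prod) auto
  moreover have "degree W \<le> t * degree G + t * (degree h - 1)"
  proof -
    have "degree (monom 1 1 + G) \<le> degree G"
      using G by (intro degree_add_le) (auto intro: order_trans[OF degree_monom_le])
    moreover have "degree (pderiv h) \<le> degree h - 1"
      by (intro degree_le) (auto simp: coeff_pderiv coeff_eq_0)
    ultimately show ?thesis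
      using G h by (auto simp: W_def degree_mult_eq degree_power_eq intro!: add_mono)
  qed
  ultimately have "card I \<le> t * degree G + t * (degree h - 1)"
    by simp
  then have "card I + t \<le> t * degree G + (t * (degree h - 1) + t)"
    by simp
  also have "t * (degree h - 1) + t = degree G"
    using deg \<open>degree h > 0\<close> by (cases "degree h") auto
  finally have "card I + t \<le> (t + 1) * degree G"
    by simp
  with \<open>t \<le> degree G\<close> show ?thesis
    using that by (simp add: t_def)
qed

section \<open>Polynomials in two variables: total degree, division, substitution\<close>

text \<open>\<open>X\<close> is the outer variable. Zero coefficients are exempted because the zero
  polynomial has degree 0, which would wrongly force \<open>j \<le> d\<close>.\<close>

definition total_degree_le :: "'a :: comm_ring_1 poly poly \<Rightarrow> nat \<Rightarrow> bool" where
  "total_degree_le F d \<longleftrightarrow> (\<forall>j. coeff F j = 0 \<or> degree (coeff F j) + j \<le> d)"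

lemma total_degree_le_diff:
  assumes "total_degree_le F d" "total_degree_le F' d"
  shows "total_degree_le (F - F') d"
  unfolding total_degree_le_def
proof
  fix j
  show "coeff (F - F') j = 0 \<or> degree (coeff (F - F') j) + j \<le> d"
    using assms[unfolded total_degree_le_def, THEN spec, of j]
      degree_diff_le_max[of "coeff F j" "coeff F' j"]
    by (auto simp: max_def split: if_splits)
qed

lemma total_degree_le_mult:
  fixes F F' :: "'a :: idom poly poly"
  assumes "total_degree_le F d" "total_degree_le F' d'"
  shows "total_degree_le (F * F') (d + d')"
  unfolding total_degree_le_def
proof
  fix j
  have *: "coeff F i * coeff F' (j - i) = 0 \<or> degree (coeff F i * coeff F' (j - i)) + j \<le> d + d'"
    if "i \<le> j" for i
    using assms(1)[unfolded total_degree_le_def, THEN spec, of i]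
      assms(2)[unfolded total_degree_le_def, THEN spec, of "j - i"] that
      degree_mult_le[of "coeff F i" "coeff F' (j - i)"]
    by fastforce
  show "coeff (F * F') j = 0 \<or> degree (coeff (F * F') j) + j \<le> d + d'"
  proof (cases "j \<le> d + d'")
    case True
    have "degree (coeff (F * F') j) \<le> d + d' - j"
      unfolding coeff_mult using * True by (intro degree_sum_le) fastforce+
    then show ?thesis using True by linarith
  next
    case False
    then have "coeff (F * F') j = 0"
      unfolding coeff_mult using * by (intro sum.neutral) fastforce
    then show ?thesis by simp
  qed
qed

text \<open>Division by a polynomial monic in \<open>X\<close>, one power at a time: subtracting
  \<open>c\<close> times \<open>R\<close> cancels the term of degree \<open>n\<close> created by
  multiplication with \<open>X\<close>, and the degree of \<open>c\<close> is small enough to keep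
  the total degree bound. The sign of \<open>g\<close> makes \<open>R\<close> divide
  \<open>X^k + g\<close>.\<close>

lemma monom_division_total_degree:
  fixes R :: "'a :: idom poly poly"
  assumes "n > 0" "degree R = n" "lead_coeff R = 1" "total_degree_le R n"
  shows "\<exists>f g. monom 1 k = R * f - g \<and> (\<forall>j\<ge>n. coeff g j = 0) \<and> total_degree_le g k"
proof (induction k)
  case 0
  show ?case
    by (rule exI[of _ 0], rule exI[of _ "-1"]) (use assms in \<open>auto simp: total_degree_le_def\<close>)
next
  case (Suc k)
  then obtain f g where fg: "monom 1 k = R * f - g" "\<forall>j\<ge>n. coeff g j = 0" "total_degree_le g k"
    by blast
  define c where "c = coeff g (n - 1)"
  define g' where "g' = pCons 0 g - [:c:] * R"
  have "monom 1 (Suc k) = pCons 0 (R * f - g)"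
    by (simp add: monom_Suc fg)
  also have "\<dots> = R * (pCons 0 f - [:c:]) - g'"
    by (simp add: g'_def algebra_simps)
  finally have "monom 1 (Suc k) = R * (pCons 0 f - [:c:]) - g'" .
  moreover have "coeff g' j = 0" if "j \<ge> n" for j
    using that assms fg(2) coeff_eq_0[of R j]
    by (cases "j = n") (auto simp: g'_def c_def coeff_pCons split: nat.split)
  moreover have "total_degree_le g' (Suc k)"
    unfolding g'_def
  proof (rule total_degree_le_diff)
    show "total_degree_le (pCons 0 g) (Suc k)"
      using fg(3) by (auto simp: total_degree_le_def coeff_pCons split: nat.split)
    show "total_degree_le ([:c:] * R) (Suc k)"
    proof (cases "c = 0")
      case False
      then have c: "degree c + (n - 1) \<le> k"
        using fg(3) by (auto simp: total_degree_le_def c_def)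
      have "total_degree_le [:c:] (degree c)"
        by (auto simp: total_degree_le_def coeff_pCons split: nat.split)
      then have "total_degree_le ([:c:] * R) (degree c + n)"
        using assms(4) by (rule total_degree_le_mult)
      then show ?thesis
        using c assms(1) unfolding total_degree_le_def by force
    qed (simp add: total_degree_le_def)
  qed
  ultimately show ?case by blast
qed

definition specialize :: "'a :: comm_ring_1 \<Rightarrow> 'a poly poly \<Rightarrow> 'a poly" where
  "specialize y F = map_poly (\<lambda>c. poly c y) F"

lemma coeff_specialize [simp]: "coeff (specialize y F) j = poly (coeff F j) y"
  by (simp add: specialize_def coeff_map_poly)

lemma specialize_diff: "specialize y (F - F') = specialize y F - specialize y F'"
  by (rule poly_eqI) simp

lemma specialize_mult: "specialize y (F * F') = specialize y F * specialize y F'"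
  by (rule poly_eqI) (simp add: coeff_mult poly_sum)

lemma specialize_linear: "specialize y [:c, 1:] = [:poly c y, 1:]"
  by (rule poly_eqI) (simp add: coeff_pCons split: nat.split)

lemma specialize_monom: "specialize y (monom 1 k) = monom 1 k"
  by (rule poly_eqI) simp

lemma specialize_prod: "specialize y (\<Prod>i\<in>I. F i) = (\<Prod>i\<in>I. specialize y (F i))"
proof (induction I rule: infinite_finite_induct)
  case (insert i I)
  then show ?case by (simp add: specialize_mult)
qed (simp_all add: specialize_monom[of y 0, unfolded monom_0 one_pCons[symmetric]])

section \<open>Directions determined by a point set\<close>

text \<open>
  The fibres of \<open>g \<mapsto> g \<cdot> y\<close> on \<open>F \<times> F\<close> are the parallel lines \<open>b = c - y a\<close>, so \<open>y\<close> names the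
  non-vertical direction of slope \<open>- y\<close>. In the affine group these lines are the left cosets
  of \<open>Stab(y)\<close>.
\<close>

definition directions :: "('a :: field \<times> 'a) set \<Rightarrow> 'a set" where
  "directions U = {y. \<not> inj_on (\<lambda>g. aff_act g y) U}"

text \<open>The remainder of \<open>X^q\<close> modulo the Redei polynomial of \<open>U\<close> has
  degree in \<open>X\<close> at most the number of directions, and at \<open>y\<close> the lacunary
  bound forces this degree up. The two conditions on \<open>y\<close> make \<open>X + G y\<close>
  nonzero and \<open>G y\<close> nonconstant.\<close>

lemma card_le_directions:
  fixes U :: "('a :: {field, finite} \<times> 'a) set"
  assumes p: "prime p" "CARD('a) = p ^ e" "e \<ge> 1"
    and U: "card U \<le> CARD('a)"
    and y: "y \<in> directions U" "\<And>c. \<exists>g\<in>U. aff_act g y \<noteq> c"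
  shows "card U \<le> (p ^ (e div 2) + 1) * card (directions U)"
proof -
  define n where "n = card U"
  define D where "D = directions U"
  have "U \<noteq> {}"
    using y(2) by auto
  then have "n > 0"
    by (simp add: n_def card_gt_0_iff)
  have "card U \<noteq> 1"
    using y(1) by (auto simp: directions_def card_1_singleton_iff)
  with \<open>n > 0\<close> have "n \<ge> 2"
    by (simp add: n_def)
  have "card D \<ge> 1"
    using y(1) by (auto simp: D_def Suc_le_eq card_gt_0_iff)
  have ch: "CHAR('a) = p"
    using CHAR_eq_prime p by blast
  \<comment> \<open>The Redei polynomial of \<open>U\<close>: specialized at \<open>z\<close> it has
    the roots \<open>aff_act g z\<close>, which are distinct unless \<open>z\<close> is a
    direction.\<close>
  define R where "R = (\<Prod>g\<in>U. [:[:- snd g, - fst g:], 1:])"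
  have R_deg: "degree R = n"
    unfolding R_def n_def by (subst degree_prod_sum_eq) auto
  have R_lead: "lead_coeff R = 1"
    by (simp add: R_def lead_coeff_prod)
  have R_total: "total_degree_le R n"
  proof -
    have "total_degree_le (\<Prod>g\<in>V. [:[:- snd g, - fst g:], 1:]) (card V)" if "finite V"
      for V :: "('a \<times> 'a) set"
      using that
    proof (induction V rule: finite_induct)
      case (insert g V)
      have "total_degree_le [:[:- snd g, - fst g:], 1:] 1"
        by (auto simp: total_degree_le_def coeff_pCons split: nat.split)
      then show ?case
        using total_degree_le_mult[OF _ insert.IH] insert.hyps by fastforce
    qed (simp add: total_degree_le_def)
    then show ?thesis
      by (simp add: R_def n_def)
  qed
  have R_y: "specialize z R = (\<Prod>g\<in>U. [:- aff_act g z, 1:])" for z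
    unfolding R_def specialize_prod specialize_linear
    by (intro prod.cong) (auto simp: aff_act_def algebra_simps)
  \<comment> \<open>For \<open>z \<notin> D\<close> the \<open>n\<close> distinct roots of \<open>R(X, z)\<close> are roots of \<open>X + g(X, z)\<close>, which has degree
    below \<open>n\<close>. Hence \<open>g(X, z) = - X\<close>, and a coefficient of \<open>g\<close> of small degree in the second
    variable has too many zeros \<open>z\<close> not to vanish identically.\<close>
  obtain F g where Fg: "monom 1 CARD('a) = R * F - g" "\<forall>j\<ge>n. coeff g j = 0"
    "total_degree_le g CARD('a)"
    using monom_division_total_degree[OF \<open>n > 0\<close> R_deg R_lead R_total] by blast
  define G where "G = (\<lambda>z. specialize z g)"
  have dvd: "(\<Prod>g\<in>U. [:- aff_act g z, 1:]) dvd monom 1 CARD('a) + G z" for z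
  proof -
    have "monom 1 CARD('a) = specialize z R * specialize z F - G z"
      by (metis Fg(1) G_def specialize_diff specialize_monom specialize_mult)
    then have "monom 1 CARD('a) + G z = specialize z R * specialize z F"
      by simp
    then show ?thesis
      by (simp flip: R_y)
  qed
  have root: "poly (monom 1 1 + G z) (aff_act h z) = 0" if "h \<in> U" for h z
  proof -
    have "[:- aff_act h z, 1:] dvd monom 1 CARD('a) + G z"
      using that by (intro dvd_trans[OF dvd_prodI dvd]) auto
    then have "poly (monom 1 CARD('a) + G z) (aff_act h z) = 0"
      using poly_eq_0_iff_dvd by blast
    then show ?thesis
      by (simp add: poly_monom power_card_eq_same)
  qed
  have deg_G_n: "degree (G z) < n" for z
    using Fg(2) \<open>n > 0\<close> by (intro degree_lessI) (auto simp: G_def)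
  have G_outside: "monom 1 1 + G z = 0" if "z \<notin> D" for z
  proof (rule ccontr)
    assume nz: "monom 1 1 + G z \<noteq> 0"
    have "n = card ((\<lambda>h. aff_act h z) ` U)"
      using that by (simp add: D_def directions_def card_image n_def)
    also have "\<dots> \<le> card {x. poly (monom 1 1 + G z) x = 0}"
      using root by (intro card_mono) auto
    also have "\<dots> \<le> degree (monom 1 1 + G z)"
      using nz by (rule card_poly_roots_bound)
    also have "\<dots> < n"
      using deg_G_n[of z] \<open>n \<ge> 2\<close>
      by (intro degree_add_less) (auto simp: degree_monom_eq)
    finally show False by simp
  qed
  have deg_G_D: "degree (G z) \<le> card D" for z
  proof (rule degree_le, safe)
    fix j assume j: "card D < j"
    have "coeff g j = 0"
    proof (rule ccontr)
      assume nz: "coeff g j \<noteq> 0"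
      then have deg: "degree (coeff g j) + j \<le> CARD('a)"
        using Fg(3) by (auto simp: total_degree_le_def)
      have "poly (coeff g j) z = 0" if "z \<notin> D" for z
      proof -
        \<comment> \<open>Since \<open>D\<close> is nonempty, \<open>j > 1\<close>, so the monomial
          \<open>X\<close> does not contribute to this coefficient.\<close>
        have "coeff (monom 1 1 + G z) j = 0"
          using G_outside[OF that] by simp
        then show ?thesis
          using j \<open>card D \<ge> 1\<close> by (simp add: G_def)
      qed
      then have "card (- D) \<le> card {z. poly (coeff g j) z = 0}"
        by (intro card_mono) auto
      also have "\<dots> \<le> degree (coeff g j)"
        using nz by (rule card_poly_roots_bound)
      finally show False
        using deg j card_Diff_subset[of D UNIV] card_mono[of UNIV D] by (simp add: Compl_eq_Diff_UNIV)
    qed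
    then show "coeff (G z) j = 0"
      by (simp add: G_def)
  qed
  \<comment> \<open>Otherwise two elements agreeing at \<open>y\<close> yield a double root of
    \<open>X^q - X\<close>, whose derivative is the constant \<open>-1\<close>.\<close>
  have G1: "monom 1 1 + G y \<noteq> 0"
  proof
    assume "monom 1 1 + G y = 0"
    then have G: "G y = - monom 1 1"
      by (simp add: add_eq_0_iff)
    obtain g h where gh: "g \<in> U" "h \<in> U" "g \<noteq> h" "aff_act g y = aff_act h y"
      using y(1) by (auto simp: directions_def inj_on_def)
    have "(\<Prod>i\<in>{g, h}. [:- aff_act i y, 1:]) dvd (\<Prod>i\<in>U. [:- aff_act i y, 1:])"
      using gh by (intro prod_dvd_prod_subset) auto
    moreover have "(\<Prod>i\<in>{g, h}. [:- aff_act i y, 1:]) = [:- aff_act g y, 1:] ^ Suc 1"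
      using gh(3) by (simp add: gh(4) del: mult_pCons_left mult_pCons_right)
    ultimately have "[:- aff_act g y, 1:] ^ Suc 1 dvd monom 1 CARD('a) + G y"
      using dvd_trans[OF _ dvd[of y]] by metis
    then have "[:- aff_act g y, 1:] ^ 1 dvd pderiv (monom 1 CARD('a) + G y)"
      by (rule linear_power_dvd_pderiv)
    moreover have "of_nat CARD('a) = (0 :: 'a)"
      using p ch by (subst of_nat_eq_0_iff_char_dvd) simp
    ultimately have "[:- aff_act g y, 1:] dvd - 1"
      by (simp add: G pderiv_diff pderiv_monom monom_0 one_pCons)
    then show False
      by (simp add: dvd_iff_poly_eq_0)
  qed
  have G2: "degree (G y) > 0"
  proof (rule ccontr)
    assume "\<not> degree (G y) > 0"
    then obtain c where "G y = [:c:]"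
      using degree_eq_zeroE by blast
    then have "aff_act h y = - c" if "h \<in> U" for h
      using root[OF that, of y] by (simp add: poly_monom add_eq_0_iff2)
    then show False
      using y(2) by blast
  qed
  have G3: "degree (G y) < CARD('a)"
    using deg_G_n[of y] U by (simp add: n_def)
  obtain k where k: "p ^ k \<le> degree (G y)" "card U + p ^ k \<le> (p ^ k + 1) * degree (G y)"
    using lacunary_degree_bound[OF p _ dvd G1 G2 G3] by auto
  have p1: "p > 1"
    using p prime_gt_1_nat by blast
  show ?thesis
  \<comment> \<open>For larger \<open>k\<close> the bound \<open>p ^ k \<le> degree (G y)\<close>
    suffices, because then \<open>e \<le> e div 2 + k\<close>.\<close>
  proof (cases "k \<le> e div 2")
    case True
    have "card U \<le> (p ^ k + 1) * degree (G y)"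
      using k(2) by simp
    also have "\<dots> \<le> (p ^ (e div 2) + 1) * card D"
      using True p1 deg_G_D[of y] by (intro mult_mono add_mono power_increasing) auto
    finally show ?thesis
      by (simp add: D_def)
  next
    case False
    have "card U \<le> p ^ e"
      using U p by simp
    also have "\<dots> \<le> p ^ (e div 2 + k)"
      using False p1 by (intro power_increasing) auto
    also have "\<dots> \<le> p ^ (e div 2) * card D"
      using k(1) deg_G_D[of y] by (simp add: power_add)
    also have "\<dots> \<le> (p ^ (e div 2) + 1) * card D"
      by simp
    finally show ?thesis
      by (simp add: D_def)
  qed
qed

section \<open>Growth in groups\<close>

context group
begin

text \<open>Send \<open>(c, x)\<close> to
  \<open>(\<alpha> c \<otimes> x, inv x \<otimes> \<beta> c)\<close> for a fixed factorization
  \<open>c = \<alpha> c \<otimes> \<beta> c\<close>. The product of the two components returns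
  \<open>c\<close>, and the first then returns \<open>x\<close>.\<close>

lemma Ruzsa_triangle:
  assumes "finite A" "finite B" "finite X"
    and sub: "A \<subseteq> carrier G" "B \<subseteq> carrier G" "X \<subseteq> carrier G"
  shows "card (A <#> B) * card X \<le> card (A <#> X) * card (set_inv X <#> B)"
proof -
  have fin: "finite (P <#> Q)" if "finite P" "finite Q" for P Q
    using that by (simp add: set_mult_def)
  have "\<exists>a b. a \<in> A \<and> b \<in> B \<and> c = a \<otimes> b" if "c \<in> A <#> B" for c
    using that by (auto simp: set_mult_def)
  then obtain \<alpha> \<beta> where
    ab: "\<And>c. c \<in> A <#> B \<Longrightarrow> \<alpha> c \<in> A \<and> \<beta> c \<in> B \<and> c = \<alpha> c \<otimes> \<beta> c"
    by metis
  define f where "f = (\<lambda>(c, x). (\<alpha> c \<otimes> x, inv x \<otimes> \<beta> c))"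
  have "card ((A <#> B) \<times> X) \<le> card ((A <#> X) \<times> (set_inv X <#> B))"
  proof (rule card_inj_on_le[where f = f])
    show "finite ((A <#> X) \<times> (set_inv X <#> B))"
      using assms by (intro finite_cartesian_product fin) (auto simp: SET_INV_def)
    show "f ` ((A <#> B) \<times> X) \<subseteq> (A <#> X) \<times> (set_inv X <#> B)"
      using ab by (fastforce simp: f_def set_mult_def SET_INV_def)
    show "inj_on f ((A <#> B) \<times> X)"
    proof (rule inj_onI, clarify)
      fix c x c' x'
      assume c: "c \<in> A <#> B" "c' \<in> A <#> B" and x: "x \<in> X" "x' \<in> X"
        and eq: "f (c, x) = f (c', x')"
      have prod: "(\<alpha> d \<otimes> y) \<otimes> (inv y \<otimes> \<beta> d) = d" if "d \<in> A <#> B" "y \<in> X" for d y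
      proof -
        have "\<alpha> d \<in> carrier G" "\<beta> d \<in> carrier G" "y \<in> carrier G"
          using ab[OF that(1)] that sub by auto
        then have "(\<alpha> d \<otimes> y) \<otimes> (inv y \<otimes> \<beta> d) = \<alpha> d \<otimes> \<beta> d"
          by (metis inv_closed m_assoc m_closed r_inv l_one)
        then show ?thesis
          using ab[OF that(1)] by simp
      qed
      have "c = c'"
        using prod[OF c(1) x(1)] prod[OF c(2) x(2)] eq by (simp add: f_def)
      moreover have "\<alpha> c \<otimes> x = \<alpha> c \<otimes> x'"
        using eq \<open>c = c'\<close> by (simp add: f_def)
      then have "x = x'"
        using ab[OF c(1)] x sub by (simp add: subset_iff)
      ultimately show "c = c' \<and> x = x'" by simp
    qed
  qed
  then show ?thesis
    by (simp add: card_cartesian_product)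
qed

lemma set_pow_subset_carrier: "A \<subseteq> carrier G \<Longrightarrow> set_pow G A k \<subseteq> carrier G"
  by (induction k) (simp_all add: set_mult_closed)

lemma finite_set_pow: "finite A \<Longrightarrow> finite (set_pow G A k)"
  by (induction k) (auto simp: set_mult_def)

lemma set_pow_add:
  assumes "A \<subseteq> carrier G"
  shows "set_pow G A (j + k) = set_pow G A j <#> set_pow G A k"
proof (induction k)
  case 0
  have "set_pow G A j <#> {\<one>} = (\<lambda>x. x \<otimes> \<one>) ` set_pow G A j"
    by (auto simp: set_mult_def)
  also have "\<dots> = (\<lambda>x. x) ` set_pow G A j"
    by (rule image_cong) (use set_pow_subset_carrier[OF assms, of j] in auto)
  finally show ?case by simp
next
  case (Suc k)
  then show ?case
    using assms by (simp add: set_mult_assoc set_pow_subset_carrier)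
qed

lemma set_pow_1:
  assumes "A \<subseteq> carrier G"
  shows "set_pow G A 1 = A"
proof -
  have "set_pow G A 1 = (\<lambda>x. \<one> \<otimes> x) ` A"
    by (auto simp: set_mult_def)
  also have "\<dots> = (\<lambda>x. x) ` A"
    by (rule image_cong) (use assms in auto)
  finally show ?thesis by simp
qed

lemma set_pow_3: "A \<subseteq> carrier G \<Longrightarrow> set_pow G A 3 = A <#> set_pow G A 2"
  using set_pow_add[of A 1 2] set_pow_1[of A] by (simp only: one_plus_numeral add_One numeral_eq_iff) simp

lemma set_pow_SucI: "x \<in> set_pow G A k \<Longrightarrow> a \<in> A \<Longrightarrow> x \<otimes> a \<in> set_pow G A (Suc k)"
  by (auto simp: set_mult_def)

lemma set_pow_inv_closed:
  assumes "A \<subseteq> carrier G" "set_inv A = A" "x \<in> set_pow G A k"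
  shows "inv x \<in> set_pow G A k"
  using assms(3)
proof (induction k arbitrary: x)
  case (Suc k)
  then obtain y a where ya: "y \<in> set_pow G A k" "a \<in> A" "x = y \<otimes> a"
    by (auto simp: set_mult_def)
  have "inv a \<in> A"
    using assms(2) ya(2) by (auto simp: SET_INV_def)
  moreover have "inv x = inv a \<otimes> inv y"
    unfolding ya(3)
    by (rule inv_mult_group) (use ya(1,2) assms(1) set_pow_subset_carrier[OF assms(1), of k] in auto)
  ultimately have "inv x \<in> set_pow G A 1 <#> set_pow G A k"
    using Suc.IH[OF ya(1)] set_pow_1[OF assms(1)] by (auto simp: set_mult_def)
  then show ?case
    using set_pow_add[OF assms(1), of 1 k] by simp
qed simp

text \<open>The powers need not be nested, as the identity may lie outside \<open>A\<close>; right
  translation by one element of \<open>A\<close> gives the injections.\<close>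

lemma card_set_pow_mono:
  assumes "A \<subseteq> carrier G" "finite A" "A \<noteq> {}" "j \<le> k"
  shows "card (set_pow G A j) \<le> card (set_pow G A k)"
proof -
  have "card (set_pow G A i) \<le> card (set_pow G A (Suc i))" for i
  proof -
    obtain a where a: "a \<in> A"
      using assms by blast
    show ?thesis
    proof (rule card_inj_on_le[where f = "\<lambda>x. x \<otimes> a"])
      show "inj_on (\<lambda>x. x \<otimes> a) (set_pow G A i)"
        using a assms(1) set_pow_subset_carrier[OF assms(1), of i]
        by (auto simp: inj_on_def subset_iff)
      show "(\<lambda>x. x \<otimes> a) ` set_pow G A i \<subseteq> set_pow G A (Suc i)"
        using a set_pow_SucI by blast
    qed (rule finite_set_pow[OF assms(2)])
  qed
  then show ?thesis
    using assms(4) by (rule lift_Suc_mono_le)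
qed

text \<open>Ruzsa's inequality for \<open>A^j\<close> and \<open>A^2\<close> with
  \<open>X = A\<close>, together with symmetry, shows that passing from \<open>A^(j+1)\<close> to
  \<open>A^(j+2)\<close> costs a factor \<open>C\<close>. Two such steps lead from
  \<open>A^3\<close> to \<open>A^5\<close>.\<close>

lemma card_set_pow_5_le:
  fixes C :: real
  assumes A: "A \<subseteq> carrier G" "finite A" "A \<noteq> {}" "set_inv A = A"
    and C: "real (card (set_pow G A 3)) = C * real (card A)"
  shows "real (card (set_pow G A 5)) \<le> C ^ 3 * real (card A)"
proof -
  have tri: "card (set_pow G A (j + 2)) * card A \<le> card (set_pow G A (j + 1)) * card (set_pow G A 3)" for j
  proof -
    have "card (set_pow G A j <#> set_pow G A 2) * card A
        \<le> card (set_pow G A j <#> A) * card (set_inv A <#> set_pow G A 2)"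
      using A by (intro Ruzsa_triangle finite_set_pow set_pow_subset_carrier)
    then show ?thesis
      using A(4) set_pow_add[OF A(1), of j 2] set_pow_add[OF A(1), of j 1]
        set_pow_3[OF A(1)] set_pow_1[OF A(1)]
      by (simp del: set_pow.simps)
  qed
  define n where "n = real (card A)"
  have n: "n > 0"
    using A by (simp add: n_def card_gt_0_iff)
  have "C * n \<ge> 0"
    using C by (simp flip: n_def)
  then have C0: "C \<ge> 0"
    using n by (simp add: zero_le_mult_iff)
  have step: "real (card (set_pow G A (j + 2))) \<le> C * real (card (set_pow G A (j + 1)))" for j
  proof -
    have "real (card (set_pow G A (j + 2))) * n \<le> real (card (set_pow G A (j + 1))) * (C * n)"
      using tri[of j] C unfolding n_def by (metis of_nat_le_iff of_nat_mult)
    then show ?thesis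
      using n by (simp add: mult.commute mult.left_commute)
  qed
  have "real (card (set_pow G A 5)) \<le> C * real (card (set_pow G A 4))"
    using step[of 3] by simp
  also have "\<dots> \<le> C * (C * real (card (set_pow G A 3)))"
    using step[of 2] C0 by (intro mult_left_mono) simp_all
  also have "\<dots> = C ^ 3 * real (card A)"
    by (simp add: C power3_eq_cube)
  finally show ?thesis .
qed

end

section \<open>Symmetric subsets of the affine group\<close>

lemma inv_aff_group:
  assumes "(a, b) \<in> carrier aff_group"
  shows "inv\<^bsub>aff_group\<^esub> (a, b) = (inverse a, - (b / a))"
proof (rule group.inv_equality[OF group_aff_group])
  show "(inverse a, - (b / a)) \<otimes>\<^bsub>aff_group\<^esub> (a, b) = \<one>\<^bsub>aff_group\<^esub>"
    using assms by (simp add: carrier_aff_group mult_aff_group one_aff_group field_simps)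
qed (use assms in \<open>auto simp: carrier_aff_group\<close>)

lemma aff_act_mult: "aff_act (g \<otimes>\<^bsub>aff_group\<^esub> h) x = aff_act g (aff_act h x)"
  by (cases g; cases h) (simp add: mult_aff_group aff_act_def algebra_simps)

lemma aff_act_inv:
  assumes "g \<in> carrier aff_group"
  shows "aff_act (inv\<^bsub>aff_group\<^esub> g) (aff_act g x) = x"
  using assms by (cases g) (simp add: carrier_aff_group inv_aff_group aff_act_def field_simps)

text \<open>The conjugate keeps the projection \<open>c\<close> of \<open>g\<close> and fixes
  \<open>z = aff_act a x\<close>, which forces its second coordinate to be
  \<open>(1 - c) * z\<close>.\<close>

lemma aff_conj:
  assumes "a \<in> carrier aff_group" "g \<in> carrier aff_group" "aff_act g x = x"
  shows "a \<otimes>\<^bsub>aff_group\<^esub> g \<otimes>\<^bsub>aff_group\<^esub> inv\<^bsub>aff_group\<^esub> a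
    = (aff_proj g, (1 - aff_proj g) * aff_act a x)"
proof -
  obtain s b c d where *: "a = (s, b)" "g = (c, d)"
    by (cases a; cases g) auto
  have s: "s \<noteq> 0"
    using assms(1) by (simp add: * carrier_aff_group)
  have "c * x + d = x"
    using assms(3) by (simp add: * aff_act_def)
  then have d: "d = (1 - c) * x"
    by (simp add: left_diff_distrib eq_diff_eq add.commute)
  moreover have "s * c * - (b / s) = - (c * b)"
    using s by simp
  ultimately have "s * c * - (b / s) + (s * d + b) = (1 - c) * (s * x + b)"
    by (simp only: d) (simp add: distrib_left left_diff_distrib right_diff_distrib mult_ac)
  then show ?thesis
    using s by (simp add: * mult_aff_group inv_aff_group carrier_aff_group aff_proj_def aff_act_def)
qed

lemma card_aff_fixed_points_le:
  fixes g h :: "'a :: {field, finite} \<times> 'a"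
  assumes "g \<noteq> h"
  shows "card {x. aff_act g x = aff_act h x} \<le> 1"
proof (rule card_le_Suc0_iff_eq[THEN iffD2, unfolded One_nat_def[symmetric], OF finite], safe)
  fix x y
  assume *: "aff_act g x = aff_act h x" "aff_act g y = aff_act h y"
  have "(fst g - fst h) * (x - y) = (aff_act g x - aff_act h x) - (aff_act g y - aff_act h y)"
    by (simp add: aff_act_def case_prod_unfold algebra_simps)
  then have "(fst g - fst h) * (x - y) = 0"
    using * by simp
  then show "x = y"
    using assms * by (auto simp: aff_act_def case_prod_unfold prod_eq_iff)
qed

section \<open>Conjugates and orbits of a symmetric set\<close>

locale symmetric_aff_set =
  fixes A :: "('a :: {field, finite} \<times> 'a) set"
  assumes carrier: "A \<subseteq> carrier aff_group"
    and symmetric: "set_inv\<^bsub>aff_group\<^esub> A = A"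
begin

sublocale group "aff_group :: ('a \<times> 'a) monoid"
  by (rule group_aff_group)

abbreviation orbit_of :: "'a \<Rightarrow> 'a set" where
  "orbit_of x \<equiv> (\<lambda>g. aff_act g x) ` A"

lemma inv_mem: "g \<in> A \<Longrightarrow> inv\<^bsub>aff_group\<^esub> g \<in> A"
  using symmetric by (auto simp: SET_INV_def)

lemma mem_carrier: "g \<in> A \<Longrightarrow> g \<in> carrier aff_group"
  using carrier by blast

lemma set_pow_2I: "g \<in> A \<Longrightarrow> h \<in> A \<Longrightarrow> g \<otimes>\<^bsub>aff_group\<^esub> h \<in> set_pow aff_group A 2"
  using set_pow_SucI[of g A 1 h] set_pow_1[OF carrier] by (simp add: numeral_2_eq_2 del: set_pow.simps)

text \<open>Two elements of \<open>A\<close> agreeing at \<open>x\<close> have a quotient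
  \<open>k\<close> in \<open>A\<^sup>2\<close> that fixes \<open>x\<close>; its conjugates share one
  projection \<open>c\<close>. A translation with a fixed point is trivial, so
  \<open>c \<noteq> 1\<close>, and distinct \<open>z\<close> give distinct conjugates.\<close>

lemma conjugates_mem:
  assumes "x \<in> directions A"
  obtains c where "c \<noteq> 0" "c \<noteq> 1" "\<forall>z\<in>orbit_of x. (c, (1 - c) * z) \<in> set_pow aff_group A 4"
proof -
  obtain g h where gh: "g \<in> A" "h \<in> A" "g \<noteq> h" "aff_act g x = aff_act h x"
    using assms by (auto simp: directions_def inj_on_def)
  define k where "k = inv\<^bsub>aff_group\<^esub> h \<otimes>\<^bsub>aff_group\<^esub> g"
  have k: "k \<in> carrier aff_group"
    using gh mem_carrier by (simp add: k_def)
  have fix_k: "aff_act k x = x"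
    using gh mem_carrier by (simp add: k_def aff_act_mult aff_act_inv)
  have k2: "k \<in> set_pow aff_group A 2"
    using gh by (auto simp: k_def intro!: set_pow_2I inv_mem)
  show ?thesis
  proof
    show "aff_proj k \<noteq> 0"
      using k by (cases k) (simp add: carrier_aff_group aff_proj_def)
    show "aff_proj k \<noteq> 1"
    proof
      assume "aff_proj k = 1"
      then have "k = \<one>\<^bsub>aff_group\<^esub>"
        using fix_k by (cases k) (simp add: aff_proj_def aff_act_def one_aff_group)
      then have "g = h"
        using gh(1,2) mem_carrier unfolding k_def by (metis inv_closed inv_inv inv_equality)
      then show False
        using gh(3) by simp
    qed
    show "\<forall>z\<in>orbit_of x. (aff_proj k, (1 - aff_proj k) * z) \<in> set_pow aff_group A 4"
    proof
      fix z assume "z \<in> orbit_of x"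
      then obtain a where a: "a \<in> A" "z = aff_act a x"
        by blast
      have "a \<otimes>\<^bsub>aff_group\<^esub> k \<in> set_pow aff_group A 3"
        using a k2 set_pow_3[OF carrier]
        by (auto simp: set_mult_def simp del: set_pow.simps)
      then have "a \<otimes>\<^bsub>aff_group\<^esub> k \<otimes>\<^bsub>aff_group\<^esub> inv\<^bsub>aff_group\<^esub> a \<in> set_pow aff_group A (Suc 3)"
        using a inv_mem by (intro set_pow_SucI)
      then show "(aff_proj k, (1 - aff_proj k) * z) \<in> set_pow aff_group A 4"
        using a aff_conj[OF mem_carrier k fix_k] by (simp del: set_pow.simps)
    qed
  qed
qed

lemma card_proj_orbit_le:
  assumes "x \<in> directions A"
  shows "card (aff_proj ` A) * card (orbit_of x) \<le> card (set_pow aff_group A 5)"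
proof -
  obtain c where c: "c \<noteq> 0" "c \<noteq> 1"
    "\<forall>z\<in>orbit_of x. (c, (1 - c) * z) \<in> set_pow aff_group A 4"
    by (rule conjugates_mem[OF assms])
  have "\<exists>b. (u, b) \<in> A" if "u \<in> aff_proj ` A" for u
    using that by (auto simp: aff_proj_def)
  then obtain \<beta> where \<beta>: "\<And>u. u \<in> aff_proj ` A \<Longrightarrow> (u, \<beta> u) \<in> A"
    by metis
  \<comment> \<open>The first coordinate \<open>c * u\<close> of the product determines
    \<open>u\<close>; then the second, \<open>c * \<beta> u + (1 - c) * z\<close>, determines
    \<open>z\<close>.\<close>
  define f where "f = (\<lambda>(u, z). (c, (1 - c) * z) \<otimes>\<^bsub>aff_group\<^esub> (u, \<beta> u))"
  have "card (aff_proj ` A \<times> orbit_of x) \<le> card (set_pow aff_group A (Suc 4))"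
  proof (rule card_inj_on_le[where f = f])
    show "inj_on f (aff_proj ` A \<times> orbit_of x)"
      using c by (auto simp: inj_on_def f_def mult_aff_group)
    have "f (u, z) \<in> set_pow aff_group A (Suc 4)" if "u \<in> aff_proj ` A" "z \<in> orbit_of x" for u z
      unfolding f_def using set_pow_SucI[OF bspec[OF c(3) that(2)] \<beta>[OF that(1)]] by simp
    then show "f ` (aff_proj ` A \<times> orbit_of x) \<subseteq> set_pow aff_group A (Suc 4)"
      by blast
  qed simp
  then show ?thesis
    by (simp add: card_cartesian_product del: set_pow.simps)
qed

text \<open>A set covering more than half of the field meets each of its translates, so every
  \<open>v\<close> is a difference of two orbit points. The quotient of their conjugates is
  \<open>(1, (1 - c) * v)\<close>.\<close>

lemma unipotent_subset_set_pow:
  assumes "x \<in> directions A" "2 * card (orbit_of x) > CARD('a)"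
  shows "aff_unipotent \<subseteq> set_pow aff_group A 8"
proof
  fix g :: "'a \<times> 'a" assume "g \<in> aff_unipotent"
  then obtain w where g: "g = (1, w)"
    by (auto simp: aff_unipotent_def)
  obtain c where c: "c \<noteq> 0" "c \<noteq> 1"
    "\<forall>z\<in>orbit_of x. (c, (1 - c) * z) \<in> set_pow aff_group A 4"
    by (rule conjugates_mem[OF assms(1)])
  define v where "v = w / (1 - c)"
  have "orbit_of x \<inter> (+) v ` orbit_of x \<noteq> {}"
  proof
    assume "orbit_of x \<inter> (+) v ` orbit_of x = {}"
    then have "card (orbit_of x \<union> (+) v ` orbit_of x) = card (orbit_of x) + card ((+) v ` orbit_of x)"
      by (intro card_Un_disjoint) auto
    also have "card ((+) v ` orbit_of x) = card (orbit_of x)"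
      by (intro card_image) auto
    finally show False
      using assms(2) card_mono[of UNIV "orbit_of x \<union> (+) v ` orbit_of x"] by simp
  qed
  then obtain z z' where z: "z \<in> orbit_of x" "z' \<in> orbit_of x" "z = v + z'"
    by blast
  have "(c, (1 - c) * z) \<otimes>\<^bsub>aff_group\<^esub> inv\<^bsub>aff_group\<^esub> (c, (1 - c) * z')
      \<in> set_pow aff_group A 4 <#>\<^bsub>aff_group\<^esub> set_pow aff_group A 4"
    using bspec[OF c(3) z(1)] set_pow_inv_closed[OF carrier symmetric bspec[OF c(3) z(2)]]
    by (auto simp: set_mult_def simp del: set_pow.simps)
  moreover have "(c, (1 - c) * z) \<otimes>\<^bsub>aff_group\<^esub> inv\<^bsub>aff_group\<^esub> (c, (1 - c) * z') = g"
    using c by (simp add: g inv_aff_group carrier_aff_group mult_aff_group z(3) v_def field_simps)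
  ultimately show "g \<in> set_pow aff_group A 8"
    using set_pow_add[OF carrier, of 4 4] by simp
qed

section \<open>Counting elements of \<open>A\<^sup>2\<close> with fixed points\<close>

abbreviation stab_count :: "'a \<Rightarrow> nat" where
  "stab_count x \<equiv> card {g \<in> set_pow aff_group A 2. aff_act g x = x}"

text \<open>Each fibre of \<open>g \<mapsto> aff_act g x\<close> on \<open>A\<close> is moved into
  \<open>A\<^sup>2\<close> and the stabilizer of \<open>x\<close> by the inverse of one of its
  elements.\<close>

lemma card_le_orbit_stab: "card A \<le> card (orbit_of x) * stab_count x"
proof -
  have "card A = card (\<Union>z\<in>orbit_of x. {g \<in> A. aff_act g x = z})"
    by (rule arg_cong[where f = card]) auto
  also have "\<dots> \<le> (\<Sum>z\<in>orbit_of x. card {g \<in> A. aff_act g x = z})"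
    by (rule card_UN_le) simp
  also have "\<dots> \<le> (\<Sum>z\<in>orbit_of x. stab_count x)"
  proof (rule sum_mono)
    fix z assume "z \<in> orbit_of x"
    then obtain h where h: "h \<in> A" "aff_act h x = z"
      by blast
    show "card {g \<in> A. aff_act g x = z} \<le> stab_count x"
    proof (rule card_inj_on_le[where f = "\<lambda>g. inv\<^bsub>aff_group\<^esub> h \<otimes>\<^bsub>aff_group\<^esub> g"])
      show "inj_on (\<lambda>g. inv\<^bsub>aff_group\<^esub> h \<otimes>\<^bsub>aff_group\<^esub> g) {g \<in> A. aff_act g x = z}"
        by (rule inj_onI) (use h mem_carrier Units_l_cancel Units_eq in \<open>metis (no_types, lifting) inv_closed mem_Collect_eq\<close>)
      show "(\<lambda>g. inv\<^bsub>aff_group\<^esub> h \<otimes>\<^bsub>aff_group\<^esub> g) ` {g \<in> A. aff_act g x = z}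
          \<subseteq> {g \<in> set_pow aff_group A 2. aff_act g x = x}"
        using h aff_act_inv[OF mem_carrier[OF h(1)], of x]
        by (auto intro!: set_pow_2I inv_mem simp: aff_act_mult)
    qed simp
  qed
  finally show ?thesis
    by (simp add: mult.commute)
qed

text \<open>A nontrivial element fixes at most one point. The identity, counted once for every point
  of \<open>D\<close>, gives \<open>card D\<close>; strictness holds because the nontrivial elements
  miss the identity in \<open>A\<^sup>2\<close>.\<close>

lemma sum_stab_count_le:
  assumes "A \<noteq> {}"
  shows "(\<Sum>x\<in>D. stab_count x) < card (set_pow aff_group A 2) + card D"
proof -
  obtain a where "a \<in> A"
    using assms by blast
  then have one: "\<one>\<^bsub>aff_group\<^esub> \<in> set_pow aff_group A 2"
    using set_pow_2I[of a "inv\<^bsub>aff_group\<^esub> a"] inv_mem mem_carrier by simp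
  define S where "S = (\<lambda>x. {g \<in> set_pow aff_group A 2. aff_act g x = x} - {\<one>\<^bsub>aff_group\<^esub>})"
  have "stab_count x = card (S x) + 1" for x
    using one card_Suc_Diff1[of "{g \<in> set_pow aff_group A 2. aff_act g x = x}" "\<one>\<^bsub>aff_group\<^esub>"]
    by (simp add: S_def one_aff_group aff_act_def)
  then have "(\<Sum>x\<in>D. stab_count x) = (\<Sum>x\<in>D. card (S x)) + card D"
    by (simp add: sum_Suc)
  also have "(\<Sum>x\<in>D. card (S x)) = card (\<Union>x\<in>D. S x)"
  proof (rule card_UN_disjoint[symmetric])
    show "\<forall>x\<in>D. \<forall>y\<in>D. x \<noteq> y \<longrightarrow> S x \<inter> S y = {}"
    proof (intro ballI impI equals0I)
      fix x y g assume "x \<noteq> y" "g \<in> S x \<inter> S y"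
      then have g: "g \<noteq> \<one>\<^bsub>aff_group\<^esub>" "{x, y} \<subseteq> {x. aff_act g x = aff_act \<one>\<^bsub>aff_group\<^esub> x}"
        by (auto simp: S_def one_aff_group aff_act_def)
      have "card {x, y} \<le> 1"
        using card_mono[OF _ g(2)] card_aff_fixed_points_le[OF g(1)] by simp
      then show False
        using \<open>x \<noteq> y\<close> by simp
    qed
  qed auto
  also have "(\<Union>x\<in>D. S x) \<subset> set_pow aff_group A 2"
    using one by (auto simp: S_def)
  then have "card (\<Union>x\<in>D. S x) < card (set_pow aff_group A 2)"
    by (intro psubset_card_mono) simp
  finally show ?thesis by simp
qed

text \<open>By Cauchy-Schwarz \<open>|A \<cdot> x|\<close> is large when few pairs in \<open>A\<close> agree at \<open>x\<close>; average over \<open>x\<close>.\<close>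

lemma exists_large_orbit:
  assumes "card A > CARD('a)"
  obtains x where "2 * card (orbit_of x) > CARD('a)"
proof -
  define n q where "n = card A" and "q = CARD('a)"
  define E where "E = (\<lambda>x. card {(g, h). g \<in> A \<and> h \<in> A \<and> aff_act g x = aff_act h x})"
  have E_eq: "E x = (\<Sum>g\<in>A. \<Sum>h\<in>A. if aff_act g x = aff_act h x then 1 else 0)" for x
  proof -
    have "E x = card (SIGMA g:A. {h \<in> A. aff_act g x = aff_act h x})"
      unfolding E_def by (rule arg_cong[where f = card]) auto
    also have "\<dots> = (\<Sum>g\<in>A. \<Sum>h\<in>A. if aff_act g x = aff_act h x then 1 else 0)"
      by (simp add: sum.If_cases Int_def)
    finally show ?thesis .
  qed
  have CS: "n ^ 2 \<le> card (orbit_of x) * E x" for x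
  proof -
    define m where "m = (\<lambda>z. card {g \<in> A. aff_act g x = z})"
    have n: "n = (\<Sum>z\<in>orbit_of x. m z)"
      unfolding n_def m_def by (subst card_eq_sum, subst sum.image_gen[where g = "\<lambda>g. aff_act g x"]) auto
    have "E x = (\<Sum>g\<in>A. m (aff_act g x))"
      unfolding E_eq m_def by (intro sum.cong) (auto simp: sum.If_cases Int_def eq_commute)
    also have "\<dots> = (\<Sum>z\<in>orbit_of x. \<Sum>g | g \<in> A \<and> aff_act g x = z. m (aff_act g x))"
      by (rule sum.image_gen) simp
    also have "\<dots> = (\<Sum>z\<in>orbit_of x. m z ^ 2)"
      by (intro sum.cong) (auto simp: m_def power2_eq_square)
    finally have "real (E x) = (\<Sum>z\<in>orbit_of x. real (m z) ^ 2)"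
      by simp
    moreover have "real n = (\<Sum>z\<in>orbit_of x. real (m z))"
      using n by simp
    ultimately have "real n ^ 2 \<le> real (E x) * real (card (orbit_of x))"
      using sum_squared_le_sum_of_squares[of "\<lambda>z. real (m z)" "orbit_of x"] by simp
    then show ?thesis
      by (metis mult.commute of_nat_le_iff of_nat_mult of_nat_power)
  qed
  have "(\<Sum>x\<in>UNIV. E x) = (\<Sum>g\<in>A. \<Sum>h\<in>A. card {x. aff_act g x = aff_act h x})"
  proof -
    have "(\<Sum>x\<in>UNIV. E x) = (\<Sum>g\<in>A. \<Sum>h\<in>A. \<Sum>x\<in>UNIV. if aff_act g x = aff_act h x then 1 else 0)"
      unfolding E_eq by (subst sum.swap, rule sum.cong, simp, rule sum.swap)
    then show ?thesis
      by (simp add: sum.If_cases)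
  qed
  \<comment> \<open>The pair \<open>(g, g)\<close> agrees at all \<open>q\<close> points, every
    other pair at no more than one.\<close>
  also have "\<dots> \<le> (\<Sum>g\<in>A. q + (n - 1))"
  proof (rule sum_mono)
    fix g assume "g \<in> A"
    then have "(\<Sum>h\<in>A. card {x. aff_act g x = aff_act h x})
        = q + (\<Sum>h\<in>A - {g}. card {x. aff_act g x = aff_act h x})"
      by (subst sum.remove[of _ g]) (auto simp: q_def)
    also have "(\<Sum>h\<in>A - {g}. card {x. aff_act g x = aff_act h x}) \<le> (\<Sum>h\<in>A - {g}. 1)"
      by (rule sum_mono) (metis DiffD2 card_aff_fixed_points_le singletonI)
    also have "(\<Sum>h\<in>A - {g}. 1) = n - 1"
      using \<open>g \<in> A\<close> by (simp add: n_def)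
    finally show "(\<Sum>h\<in>A. card {x. aff_act g x = aff_act h x}) \<le> q + (n - 1)"
      by simp
  qed
  finally have sum_E: "(\<Sum>x\<in>UNIV. E x) \<le> n * (q + (n - 1))"
    by (simp add: n_def)
  show ?thesis
  proof (rule ccontr)
    assume "\<not> thesis"
    then have small: "2 * card (orbit_of x) \<le> q" for x
      unfolding q_def using that[of x] \<open>\<not> thesis\<close> not_le by blast
    have "2 * n ^ 2 \<le> q * E x" for x
    proof -
      have "2 * n ^ 2 \<le> (2 * card (orbit_of x)) * E x"
        using CS[of x] by simp
      also have "\<dots> \<le> q * E x"
        by (intro mult_right_mono small) simp
      finally show ?thesis .
    qed
    then have "(\<Sum>x\<in>(UNIV :: 'a set). 2 * n ^ 2) \<le> (\<Sum>x\<in>UNIV. q * E x)"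
      by (intro sum_mono)
    then have "q * (2 * n ^ 2) \<le> q * (\<Sum>x\<in>UNIV. E x)"
      by (simp add: q_def sum_distrib_left)
    also have "\<dots> \<le> q * (n * (q + (n - 1)))"
      by (intro mult_left_mono sum_E) simp
    finally have "(q * n) * (2 * n) \<le> (q * n) * (q + (n - 1))"
      by (simp add: power2_eq_square ac_simps)
    moreover have "q > 0" "n > q"
      using assms by (auto simp: q_def n_def card_gt_0_iff)
    ultimately show False by simp
  qed
qed

lemma directions_eq_UNIV:
  assumes "card A > CARD('a)"
  shows "directions A = UNIV"
  using assms card_inj_on_le[of "\<lambda>g. aff_act g x" A UNIV for x]
  by (force simp: directions_def)

text \<open>If all of \<open>A\<close> sent \<open>x\<close> to \<open>c\<close>, symmetry would
  make it send \<open>c\<close> back to \<open>x\<close>. Since \<open>c \<noteq> x\<close> outside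
  a stabilizer, only the affine map swapping the two points remains, and a single element determines
  no direction.\<close>

lemma aff_act_not_constant:
  assumes "x \<in> directions A" "\<And>y. \<not> A \<subseteq> stabilizer aff_group aff_act y"
  shows "\<exists>g\<in>A. aff_act g x \<noteq> c"
proof (rule ccontr)
  assume "\<not> ?thesis"
  then have const: "aff_act g x = c" if "g \<in> A" for g
    using that by blast
  then have "c \<noteq> x"
    using assms(2)[of x] mem_carrier by (auto simp: stabilizer_def)
  have "g = (- 1, c + x)" if "g \<in> A" for g
  proof -
    have "aff_act g c = x"
      using const[OF inv_mem[OF that]] aff_act_inv[OF inv_closed[OF mem_carrier[OF that]], of x]
        mem_carrier[OF that] by simp
    with const[OF that] have eqs: "fst g * c + snd g = x" "fst g * x + snd g = c"
      by (auto simp: aff_act_def case_prod_unfold)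
    have "(fst g + 1) * (c - x) = (fst g * c + snd g - x) - (fst g * x + snd g - c)"
      by (simp add: algebra_simps)
    then have "(fst g + 1) * (c - x) = 0"
      using eqs by simp
    then have "fst g = - 1"
      using \<open>c \<noteq> x\<close> by (simp add: eq_neg_iff_add_eq_0)
    then show ?thesis
      using eqs by (auto simp: prod_eq_iff algebra_simps)
  qed
  then show False
    using assms(1) by (auto simp: directions_def inj_on_def)
qed

text \<open>Orbit and stabilizer counts give \<open>P \<le> C ^ 3 * stab_count x\<close> at each
  direction, and these bounds are summed. The fourth factor \<open>C\<close> comes from
  \<open>card (A^2) \<le> card (A^3)\<close>; \<open>C \<ge> 1\<close> lets the other summand carry
  it too.\<close>

lemma card_proj_directions_less:
  fixes C :: real
  assumes "A \<noteq> {}" "directions A \<noteq> {}"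
    and C: "real (card (set_pow aff_group A 3)) = C * real (card A)" "C \<ge> 1"
  shows "real (card (directions A)) * real (card (aff_proj ` A))
    < C ^ 4 * (real (card A) + real (card (directions A)))"
proof -
  define n where "n = real (card A)"
  define P where "P = real (card (aff_proj ` A))"
  have n: "n > 0"
    using assms(1) by (simp add: n_def card_gt_0_iff)
  have "P \<le> C ^ 3 * real (stab_count x)" if "x \<in> directions A" for x
  proof -
    have "P * n \<le> P * (real (card (orbit_of x)) * real (stab_count x))"
      using card_le_orbit_stab[of x] unfolding n_def P_def
      by (intro mult_left_mono) (simp_all flip: of_nat_mult)
    also have "\<dots> = (P * real (card (orbit_of x))) * real (stab_count x)"
      by simp
    also have "\<dots> \<le> (C ^ 3 * n) * real (stab_count x)"
    proof (rule mult_right_mono)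
      have "P * real (card (orbit_of x)) \<le> real (card (set_pow aff_group A 5))"
        using card_proj_orbit_le[OF that] unfolding P_def by (metis of_nat_le_iff of_nat_mult)
      also have "\<dots> \<le> C ^ 3 * n"
        unfolding n_def by (rule card_set_pow_5_le) (use assms carrier symmetric in auto)
      finally show "P * real (card (orbit_of x)) \<le> C ^ 3 * n" .
    qed simp
    finally show ?thesis
      using n by simp
  qed
  then have "(\<Sum>x\<in>directions A. P) \<le> (\<Sum>x\<in>directions A. C ^ 3 * real (stab_count x))"
    by (rule sum_mono)
  then have "real (card (directions A)) * P \<le> C ^ 3 * real (\<Sum>x\<in>directions A. stab_count x)"
    by (simp add: sum_distrib_left)
  also have "\<dots> < C ^ 3 * real (card (set_pow aff_group A 2) + card (directions A))"
    using sum_stab_count_le[OF assms(1), of "directions A"] C(2)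
    by (intro mult_strict_left_mono) (simp_all only: of_nat_less_iff, simp)
  also have "\<dots> \<le> C ^ 3 * (C * n + C * real (card (directions A)))"
  proof (rule mult_left_mono)
    have "real (card (set_pow aff_group A 2)) \<le> C * n"
      using card_set_pow_mono[OF carrier _ assms(1), of 2 3] C(1)
      by (simp add: n_def del: set_pow.simps flip: C(1))
    moreover have "real (card (directions A)) \<le> C * real (card (directions A))"
      using C(2) by (simp add: mult_le_cancel_right1)
    ultimately show "real (card (set_pow aff_group A 2) + card (directions A))
        \<le> C * n + C * real (card (directions A))"
      by simp
  qed (use C(2) in simp)
  also have "\<dots> = C ^ 4 * (n + real (card (directions A)))"
    by (simp add: algebra_simps power_numeral_reduce)
  finally show ?thesis
    by (simp add: n_def P_def)
qed

text \<open>Elements with different projections agree at \<open>(d - b) / (a - c)\<close>, which is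
  then a direction. This settles the case with no direction to sum over.\<close>

lemma card_proj_le_1:
  assumes "directions A = {}"
  shows "card (aff_proj ` A) \<le> 1"
proof -
  have eq: "aff_proj g = aff_proj h" if "g \<in> A" "h \<in> A" for g h
  proof (rule ccontr)
    obtain a b c d where *: "g = (a, b)" "h = (c, d)"
      by (cases g; cases h) auto
    assume "aff_proj g \<noteq> aff_proj h"
    then have "a - c \<noteq> 0"
      by (simp add: * aff_proj_def)
    define x where "x = (d - b) / (a - c)"
    have "(a - c) * x = d - b"
      using \<open>a - c \<noteq> 0\<close> by (simp add: x_def)
    then have "a * x = c * x + (d - b)"
      by (simp add: left_diff_distrib diff_eq_eq add.commute)
    then have "aff_act g x = aff_act h x"
      by (simp add: * aff_act_def)
    then have "x \<in> directions A"
      using that \<open>aff_proj g \<noteq> aff_proj h\<close> by (auto simp: directions_def inj_on_def)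
    then show False
      using assms by simp
  qed
  show ?thesis
  proof (cases "A = {}")
    case False
    then obtain g where "g \<in> A"
      by blast
    then have "aff_proj ` A \<subseteq> {aff_proj g}"
      using eq by blast
    then show ?thesis
      using card_mono[of "{aff_proj g}" "aff_proj ` A"] by simp
  qed simp
qed

end

section \<open>The three ranges of \<open>card A\<close>\<close>

theorem theorem1p4:
  fixes p e q :: nat
    and A :: "('a::{field,finite} \<times> 'a) set"
    and C :: real
  assumes "prime p" and "e \<ge> 1" and "q = p ^ e"
    and "CARD('a) = q"
    and "A \<subseteq> carrier aff_group"
    and "set_inv\<^bsub>aff_group\<^esub> A = A"
    and "real (card (set_pow aff_group A 3)) = C * real (card A)"
  shows "(\<exists>x. A \<subseteq> stabilizer aff_group aff_act x) \<or>
    (1 < card A \<and> card A \<le> q \<longrightarrow>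
       real (card (aff_proj ` A)) < (real p ^ (e div 2) + 2) * C ^ 4) \<and>
    (real q < real (card A) \<and> real (card A) < (3 + 2 * sqrt 2) * real q \<longrightarrow>
       real (card (aff_proj ` A)) < (4 + 2 * sqrt 2) * C ^ 4) \<and>
    (real (card A) \<ge> (3 + 2 * sqrt 2) * real q \<longrightarrow>
       real (card (aff_proj ` A)) < 2 / real q * C ^ 3 * real (card A) \<and>
       aff_unipotent \<subseteq> set_pow aff_group A 8)"
proof (cases "\<exists>x. A \<subseteq> stabilizer aff_group aff_act x")
  case False
  interpret symmetric_aff_set A
    by unfold_locales (rule assms)+
  define n where "n = real (card A)"
  define P where "P = real (card (aff_proj ` A))"
  define d where "d = real (card (directions A))"
  have "A \<noteq> {}"
    using False by blast
  then have n: "n > 0" and P: "P > 0"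
    by (simp_all add: n_def P_def card_gt_0_iff)
  have q: "q > 0"
    using assms(1,3) prime_gt_0_nat by simp
  have "n \<le> C * n"
    using card_set_pow_mono[OF carrier _ \<open>A \<noteq> {}\<close>, of 1 3] assms(7) set_pow_1[OF carrier]
    by (simp add: n_def del: set_pow.simps flip: assms(7))
  then have C: "C \<ge> 1"
    using n by simp
  have key: "d * P < C ^ 4 * (n + d)" if "directions A \<noteq> {}"
    unfolding d_def P_def n_def by (rule card_proj_directions_less) fact+
  have d0: "d > 0" if "directions A \<noteq> {}"
    using that by (simp add: d_def card_gt_0_iff)
  have small: "P < (real p ^ (e div 2) + 2) * C ^ 4" if "card A \<le> q"
  proof (cases "directions A = {}")
    case True
    have "P \<le> 1 * 1"
      using card_proj_le_1[OF True] by (simp add: P_def)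
    also have "1 * 1 < (real p ^ (e div 2) + 2) * C ^ 4"
      using C by (intro mult_less_le_imp_less one_le_power) (simp_all add: add_pos_nonneg)
    finally show ?thesis .
  next
    case False
    then obtain y where y: "y \<in> directions A"
      by blast
    have "CARD('a) = p ^ e" "card A \<le> CARD('a)"
      using assms(3,4) that by simp_all
    moreover have "\<exists>g\<in>A. aff_act g y \<noteq> c" for c
      using aff_act_not_constant[OF y] \<open>\<nexists>x. A \<subseteq> stabilizer aff_group aff_act x\<close> by blast
    ultimately have "card A \<le> (p ^ (e div 2) + 1) * card (directions A)"
      using card_le_directions[OF assms(1) _ assms(2) _ y] by blast
    then have "real (card A) \<le> real ((p ^ (e div 2) + 1) * card (directions A))"
      by (simp only: of_nat_le_iff)
    then have "n \<le> (real p ^ (e div 2) + 1) * d"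
      by (simp add: n_def d_def distrib_right add.commute)
    \<comment> \<open>The constant \<open>+ 2\<close> is the \<open>+ 1\<close> of the direction
      count plus the summand \<open>d\<close> in \<open>key\<close>.\<close>
    then have "C ^ 4 * (n + d) \<le> C ^ 4 * ((real p ^ (e div 2) + 1) * d + d)"
      using C by (intro mult_left_mono add_mono) simp_all
    also have "\<dots> = d * ((real p ^ (e div 2) + 2) * C ^ 4)"
      by (simp add: algebra_simps)
    finally have "d * P < d * ((real p ^ (e div 2) + 2) * C ^ 4)"
      using key[OF False] by linarith
    then show ?thesis
      using d0[OF False] by simp
  qed
  have directions_large: "directions A = UNIV" if "n > real q"
    by (rule directions_eq_UNIV) (use that assms(4) in \<open>simp add: n_def\<close>)
  have medium: "P < (4 + 2 * sqrt 2) * C ^ 4" if "n > real q" "n < (3 + 2 * sqrt 2) * real q"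
  proof -
    have d: "d = real q" and ne: "directions A \<noteq> {}"
      using directions_large[OF that(1)] assms(4) by (simp_all add: d_def)
    \<comment> \<open>With \<open>d = q\<close>, the summand \<open>d\<close> raises
      \<open>3 + 2 * sqrt 2\<close> to \<open>4 + 2 * sqrt 2\<close>.\<close>
    have "C ^ 4 * (n + d) \<le> C ^ 4 * ((3 + 2 * sqrt 2) * d + d)"
      using C that d by (intro mult_left_mono add_mono) simp_all
    also have "\<dots> = d * ((4 + 2 * sqrt 2) * C ^ 4)"
      by (simp add: algebra_simps)
    finally have "d * P < d * ((4 + 2 * sqrt 2) * C ^ 4)"
      using key[OF ne] by linarith
    then show ?thesis
      using d0[OF ne] by simp
  qed
  have large: "P < 2 / real q * C ^ 3 * n \<and> aff_unipotent \<subseteq> set_pow aff_group A 8"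
    if "n \<ge> (3 + 2 * sqrt 2) * real q"
  proof -
    have "1 * real q < (3 + 2 * sqrt 2) * real q"
      using q by (intro mult_strict_right_mono) (simp_all add: add_pos_nonneg)
    then have nq: "n > real q"
      using that by simp
    then have "card A > CARD('a)"
      using assms(4) by (simp add: n_def)
    then obtain x where x: "2 * card (orbit_of x) > CARD('a)"
      by (rule exists_large_orbit)
    have xD: "x \<in> directions A"
      using directions_large[OF nq] by simp
    \<comment> \<open>An orbit covering more than half of the field supplies both the factor 2 and
      the strictness.\<close>
    have "P * real q < P * (2 * real (card (orbit_of x)))"
      using x P assms(4) by (intro mult_strict_left_mono) linarith+
    also have "\<dots> = 2 * (P * real (card (orbit_of x)))"
      by simp
    also have "P * real (card (orbit_of x)) \<le> real (card (set_pow aff_group A 5))"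
      using card_proj_orbit_le[OF xD] unfolding P_def by (metis of_nat_le_iff of_nat_mult)
    also have "\<dots> \<le> C ^ 3 * n"
      unfolding n_def by (rule card_set_pow_5_le) (use assms \<open>A \<noteq> {}\<close> in auto)
    finally have "P * real q < 2 * (C ^ 3 * n)"
      by simp
    then have "P < 2 / real q * C ^ 3 * n"
      using q by (simp add: field_simps)
    then show ?thesis
      using unipotent_subset_set_pow[OF xD x] by blast
  qed
  show ?thesis
    using small medium large unfolding n_def P_def by blast
qed blast

end
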